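(* Let $\mathfrak{H}=\mathfrak{H}_0\oplus\mathfrak{H}_1$ be an orthogonal decomposition of a complex separable Hilbert space, let $A_0\in\mathcal{L}(\mathfrak{H}_0)$ and $A_1\in\mathcal{L}(\mathfrak{H}_1)$ be bounded self-adjoint operators, let $V\in\mathcal{L}(\mathfrak{H}_1,\mathfrak{H}_0)$, and let $$\mathbf{B}=\begin{pmatrix} A_0 & V \\ V^\ast & A_1 \end{pmatrix}\in\mathcal{L}(\mathfrak{H}_0\oplus\mathfrak{H}_1).$$ Assume that $\mathfrak{H}_1$ is finite dimensional with $n:=\dim\mathfrak{H}_1$, and that $\operatorname{Ran}V$ is a cyclic generating subspace for $A_0$, i.e. $$\overline{\operatorname{lin\,span}\{A_0^k v \mid k\in\mathbb{N}_0,\ v\in\operatorname{Ran}V\}}=\mathfrak{H}_0 .$$ Then: (i) The multiplicity of the spectrum of $\mathbf{B}$ is at most $n$. If $\mathbf{B}$ has an eigenvalue of multiplicity $n$, then there is a bounded solution $X\in\mathcal{L}(\mathfrak{H}_0,\mathfrak{H}_1)$ to the Riccati equation $$A_1X-XA_0-XVX+V^\ast=0 .$$ (ii) Assume that $\mathbf{B}$ has at least $n$ eigenvalues, counted with multiplicities, outside the point spectrum $\operatorname{spec}_p(A_0)$, and let $U$ be the space spanned by the eigenvectors of $\mathbf{B}$ associated with its eigenvalues outside $\operatorname{spec}_p(A_0)$. Suppose furthermore that $P_{\mathfrak{H}_1}U=\mathfrak{H}_1$, where $P_{\mathfrak{H}_1}:\mathfrak{H}\to\mathfrak{H}$ is the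 orthogonal projection onto $\mathfrak{H}_1$. Then the Riccati equation $A_1X-XA_0-XVX+V^\ast=0$ has a bounded solution $X\in\mathcal{L}(\mathfrak{H}_0,\mathfrak{H}_1)$.
   Context: $\mathcal{L}(\mathfrak{H},\mathfrak{K})$ denotes the bounded linear operators from $\mathfrak{H}$ to $\mathfrak{K}$, and $\mathcal{L}(\mathfrak{H})=\mathcal{L}(\mathfrak{H},\mathfrak{H})$. The point spectrum $\operatorname{spec}_p(T)$ is the set of all eigenvalues of $T$. For a bounded self-adjoint operator $T$ on a Hilbert space $\mathfrak{H}$, a subspace $W\subset\mathfrak{H}$ is a cyclic generating subspace for $T$ if $\operatorname{lin\,span}\{T^k w\mid k\in\mathbb{N}_0,\ w\in W\}$ is dense in $\mathfrak{H}$. The multiplicity of the spectrum of $T$ is the minimal dimension of all cyclic generating subspaces for $T$. The multiplicity of an eigenvalue is the dimension of its eigenspace. *)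

theory Defs
  imports "HOL-Analysis.Analysis" "HOL-Library.Extended_Nat"
begin

section \<open>Complex Hilbert spaces\<close>

class complex_vector = real_vector +
  fixes scaleC :: "complex \<Rightarrow> 'a \<Rightarrow> 'a"  (infixr \<open>*\<^sub>C\<close> 75)
  assumes scaleC_add_right: "a *\<^sub>C (x + y) = a *\<^sub>C x + a *\<^sub>C y"
    and scaleC_add_left: "(a + b) *\<^sub>C x = a *\<^sub>C x + b *\<^sub>C x"
    and scaleC_scaleC: "a *\<^sub>C (b *\<^sub>C x) = (a * b) *\<^sub>C x"
    and scaleC_one: "1 *\<^sub>C x = x"
    and scaleR_scaleC: "r *\<^sub>R x = complex_of_real r *\<^sub>C x"

global_interpretation complex_vector: vector_space "scaleC :: complex \<Rightarrow> 'a \<Rightarrow> 'a :: complex_vector"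
  defines cspan_raw_def: cspan = complex_vector.span
    and csubspace_raw_def: csubspace = complex_vector.subspace
    and cdependent_raw_def: cdependent = complex_vector.dependent
    and crepresentation_raw_def: crepresentation = complex_vector.representation
    and cextend_basis_raw_def: cextend_basis = complex_vector.extend_basis
    and cdim_raw_def: cdim = complex_vector.dim
  by unfold_locales (auto simp: scaleC_add_right scaleC_add_left scaleC_scaleC scaleC_one)

text \<open>The complex inner product is antilinear in the first and linear in the second argument.
  The underlying real inner product of \<^class>\<open>real_inner\<close> is its real part, so that the norm is
  the one induced by the complex inner product (lemma \<open>norm_eq_sqrt_cinner\<close> below).\<close>

class complex_inner = real_inner + complex_vector +
  fixes cinner :: "'a \<Rightarrow> 'a \<Rightarrow> complex"
  assumes cinner_commute: "cinner x y = cnj (cinner y x)"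
    and cinner_add_right: "cinner x (y + z) = cinner x y + cinner x z"
    and cinner_scaleC_right: "cinner x (a *\<^sub>C y) = a * cinner x y"
    and inner_eq_Re_cinner: "inner x y = Re (cinner x y)"

class chilbert_space = complex_inner + complete_space

lemma cinner_self: "cinner x x = complex_of_real ((norm x)\<^sup>2)"
proof -
  have "Im (cinner x x) = 0"
    using arg_cong[OF cinner_commute[of x x], of Im] by simp
  moreover have "Re (cinner x x) = (norm x)\<^sup>2"
    by (simp add: inner_eq_Re_cinner[symmetric] power2_norm_eq_inner)
  ultimately show ?thesis by (simp add: complex_eq_iff)
qed

lemma norm_eq_sqrt_cinner: "norm x = sqrt (cmod (cinner x x))"
  by (simp add: cinner_self norm_power)

lemma cinner_zero_right [simp]: "cinner x 0 = 0"
  using cinner_add_right[of x 0 0] by simp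

lemma cinner_zero_left [simp]: "cinner 0 x = 0"
  by (subst cinner_commute) simp

lemma cinner_diff_right: "cinner x (y - z) = cinner x y - cinner x z"
  using cinner_add_right[of x "y - z" z] by simp

text \<open>The product type of two Hilbert spaces is their (external) orthogonal direct sum; its norm
  is \<open>sqrt ((norm x)\<^sup>2 + (norm y)\<^sup>2)\<close> by \<open>norm_Pair\<close>.\<close>

instantiation prod :: (complex_vector, complex_vector) complex_vector
begin

definition scaleC_prod_def: "a *\<^sub>C p = (a *\<^sub>C fst p, a *\<^sub>C snd p)"

instance
  by standard
    (auto simp: scaleC_prod_def scaleC_add_right scaleC_add_left scaleC_scaleC scaleC_one
      scaleR_scaleC prod_eq_iff)

end

instantiation prod :: (complex_inner, complex_inner) complex_inner
begin

definition cinner_prod_def: "cinner p q = cinner (fst p) (fst q) + cinner (snd p) (snd q)"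

instance
proof
  fix x y z :: "'a \<times> 'b" and a :: complex
  show "cinner x y = cnj (cinner y x)"
    unfolding cinner_prod_def complex_cnj_add
    by (simp only: cinner_commute[of "fst y"] cinner_commute[of "snd y"] complex_cnj_cnj)
qed (auto simp: cinner_prod_def scaleC_prod_def cinner_add_right cinner_scaleC_right
    inner_prod_def inner_eq_Re_cinner algebra_simps)

end

instance prod :: (chilbert_space, chilbert_space) chilbert_space ..

text \<open>Complex dimension of a subspace, with value \<open>\<infinity>\<close> in the infinite-dimensional case (where
  \<open>cdim\<close> is \<open>0\<close>).\<close>

definition ecdim :: "'a::complex_vector set \<Rightarrow> enat" where
  "ecdim W = (if \<exists>b. finite b \<and> W \<subseteq> cspan b then enat (cdim W) else \<infinity>)"


section \<open>Operators\<close>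

definition bounded_clinear :: "('a::complex_inner \<Rightarrow> 'b::complex_inner) \<Rightarrow> bool" where
  "bounded_clinear T \<longleftrightarrow> bounded_linear T \<and> (\<forall>a x. T (a *\<^sub>C x) = a *\<^sub>C T x)"

definition is_cadjoint ::
    "('a::complex_inner \<Rightarrow> 'b::complex_inner) \<Rightarrow> ('b \<Rightarrow> 'a) \<Rightarrow> bool" where
  "is_cadjoint T S \<longleftrightarrow> (\<forall>x y. cinner (T x) y = cinner x (S y))"

definition cadjoint :: "('a::complex_inner \<Rightarrow> 'b::complex_inner) \<Rightarrow> 'b \<Rightarrow> 'a" where
  "cadjoint T = (THE S. is_cadjoint T S)"

definition bounded_selfadjoint :: "('a::complex_inner \<Rightarrow> 'a) \<Rightarrow> bool" where
  "bounded_selfadjoint A \<longleftrightarrow> bounded_clinear A \<and> is_cadjoint A A"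

lemma is_cadjoint_unique:
  assumes "is_cadjoint T S" "is_cadjoint T S'"
  shows "S = S'"
proof
  fix y
  have "cinner (S y - S' y) (S y - S' y) = 0"
    using assms unfolding is_cadjoint_def cinner_diff_right by (metis cancel_comm_monoid_add_class.diff_cancel)
  then show "S y = S' y" by (simp add: cinner_self)
qed

lemma cadjoint_eqI: "is_cadjoint T S \<Longrightarrow> cadjoint T = S"
  unfolding cadjoint_def by (blast intro: the_equality is_cadjoint_unique)

definition orthogonal_projection :: "'a::complex_inner set \<Rightarrow> 'a \<Rightarrow> 'a" where
  "orthogonal_projection M x = (THE y. y \<in> M \<and> (\<forall>z\<in>M. cinner z (x - y) = 0))"

lemma orthogonal_projection_snd:
  "orthogonal_projection ({0} \<times> UNIV) p = (0, snd p)"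
  unfolding orthogonal_projection_def
proof (rule the_equality)
  fix q assume q: "q \<in> {0} \<times> UNIV \<and> (\<forall>z\<in>{0} \<times> UNIV. cinner z (p - q) = 0)"
  then have "cinner (0, snd p - snd q) (p - q) = 0" by blast
  then have "cinner (snd p - snd q) (snd p - snd q) = 0"
    by (simp add: cinner_prod_def)
  with q show "q = (0, snd p)" by (auto simp: cinner_self prod_eq_iff)
qed (auto simp: cinner_prod_def)

definition is_eigenvector :: "('a::complex_inner \<Rightarrow> 'a) \<Rightarrow> complex \<Rightarrow> 'a \<Rightarrow> bool" where
  "is_eigenvector T \<mu> u \<longleftrightarrow> u \<noteq> 0 \<and> T u = \<mu> *\<^sub>C u"

definition point_spectrum :: "('a::complex_inner \<Rightarrow> 'a) \<Rightarrow> complex set" where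
  "point_spectrum T = {\<mu>. \<exists>u. is_eigenvector T \<mu> u}"

definition eigenspace :: "('a::complex_inner \<Rightarrow> 'a) \<Rightarrow> complex \<Rightarrow> 'a set" where
  "eigenspace T \<mu> = {u. T u = \<mu> *\<^sub>C u}"

definition eigenvalue_multiplicity :: "('a::complex_inner \<Rightarrow> 'a) \<Rightarrow> complex \<Rightarrow> enat" where
  "eigenvalue_multiplicity T \<mu> = ecdim (eigenspace T \<mu>)"

text \<open>Number of eigenvalues of \<open>T\<close> in \<open>S\<close> counted with multiplicities, i.e. the possibly infinite
  sum of the multiplicities, as the supremum of its finite partial sums.\<close>

definition eigenvalue_count :: "('a::complex_inner \<Rightarrow> 'a) \<Rightarrow> complex set \<Rightarrow> enat" where
  "eigenvalue_count T S =
    (SUP F \<in> {F. finite F \<and> F \<subseteq> point_spectrum T \<inter> S}. \<Sum>\<mu>\<in>F. eigenvalue_multiplicity T \<mu>)"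

definition cyclic_generating_subspace :: "('a::complex_inner \<Rightarrow> 'a) \<Rightarrow> 'a set \<Rightarrow> bool" where
  "cyclic_generating_subspace T W \<longleftrightarrow>
    csubspace W \<and> closure (cspan {(T ^^ k) w | k w. w \<in> W}) = UNIV"

text \<open>The infimum is attained: \<^typ>\<open>enat\<close> is well-ordered and the whole space is a cyclic
  generating subspace.\<close>

definition spectral_multiplicity :: "('a::complex_inner \<Rightarrow> 'a) \<Rightarrow> enat" where
  "spectral_multiplicity T = (INF W \<in> {W. cyclic_generating_subspace T W}. ecdim W)"

definition block_operator ::
    "('a::complex_inner \<Rightarrow> 'a) \<Rightarrow> ('b::complex_inner \<Rightarrow> 'a) \<Rightarrow> ('a \<Rightarrow> 'b) \<Rightarrow> ('b \<Rightarrow> 'b)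
      \<Rightarrow> 'a \<times> 'b \<Rightarrow> 'a \<times> 'b" where
  "block_operator T\<^sub>0\<^sub>0 T\<^sub>0\<^sub>1 T\<^sub>1\<^sub>0 T\<^sub>1\<^sub>1 = (\<lambda>(x, y). (T\<^sub>0\<^sub>0 x + T\<^sub>0\<^sub>1 y, T\<^sub>1\<^sub>0 x + T\<^sub>1\<^sub>1 y))"

definition riccati_solution ::
    "('a::complex_inner \<Rightarrow> 'a) \<Rightarrow> ('b::complex_inner \<Rightarrow> 'b) \<Rightarrow> ('b \<Rightarrow> 'a) \<Rightarrow> ('a \<Rightarrow> 'b) \<Rightarrow> bool" where
  "riccati_solution A\<^sub>0 A\<^sub>1 V X \<longleftrightarrow>
    (\<forall>x. A\<^sub>1 (X x) - X (A\<^sub>0 x) - X (V (X x)) + cadjoint V x = 0)"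

end

theory Submission
  imports Defs
begin

text \<open>If eigenvectors of \<open>B\<close> have second components spanning \<open>H\<^sub>1\<close>, then finitely many of
  them span a \<open>B\<close>-invariant graph \<open>{(Y h, h) | h \<in> H\<^sub>1}\<close>; invariance reads
  \<open>A\<^sub>0 Y + V = Y A\<^sub>1 + Y V\<^sup>* Y\<close>, and taking adjoints shows that \<open>X = - Y\<^sup>*\<close> solves the Riccati
  equation. In (ii) the spanning condition is the assumption on \<open>U\<close>. In (i) it holds because an
  eigenvector \<open>(x, 0)\<close> would make \<open>x\<close> orthogonal to all \<open>A\<^sub>0\<^sup>k V h\<close>, so that an eigenspace projects
  injectively into \<open>H\<^sub>1\<close>. Finally \<open>{0} \<times> H\<^sub>1\<close> is a cyclic generating subspace for \<open>B\<close>, which bounds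
  the multiplicity of the spectrum.\<close>

section \<open>Complex-linear maps and the complex Cauchy-Schwarz inequality\<close>

abbreviation clinear :: "('a::complex_vector \<Rightarrow> 'b::complex_vector) \<Rightarrow> bool" where
  "clinear \<equiv> Vector_Spaces.linear scaleC scaleC"

interpretation cvp: vector_space_pair
  "scaleC :: complex \<Rightarrow> 'a::complex_vector \<Rightarrow> 'a" "scaleC :: complex \<Rightarrow> 'b::complex_vector \<Rightarrow> 'b"
  ..

lemma clinearI:
  fixes f :: "'a::complex_vector \<Rightarrow> 'b::complex_vector"
  assumes "\<And>x y. f (x + y) = f x + f y" "\<And>a x. f (a *\<^sub>C x) = a *\<^sub>C f x"
  shows "clinear f"
  by (rule Vector_Spaces.linear.intro; unfold_locales) (auto simp: assms)

lemma bounded_clinear_imp_clinear: "bounded_clinear f \<Longrightarrow> clinear f"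
  unfolding bounded_clinear_def by (auto intro!: clinearI bounded_linear.linear linear_add)

lemma cinner_add_left: "cinner (x + y) z = cinner x z + cinner y z"
  by (subst (1 2 3) cinner_commute) (simp add: cinner_add_right)

lemma cinner_scaleC_left: "cinner (a *\<^sub>C x) y = cnj a * cinner x y"
  by (subst (1 2) cinner_commute) (simp add: cinner_scaleC_right)

lemma cinner_minus_right: "cinner x (- y) = - cinner x y"
  using cinner_diff_right[of x 0 y] by simp

lemma cinner_sum_right: "cinner x (sum f A) = (\<Sum>i\<in>A. cinner x (f i))"
  by (induction A rule: infinite_finite_induct) (simp_all add: cinner_add_right)

lemma cinner_extensionality_left:
  assumes "\<And>h. cinner h x = cinner h y"
  shows "x = y"
proof -
  have "cinner (x - y) (x - y) = 0" by (simp add: cinner_diff_right assms)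
  then show ?thesis by (simp add: cinner_self)
qed

text \<open>Multiplying \<open>y\<close> by a phase \<open>a\<close> with \<open>cmod a = 1\<close>
  makes the inner product real and nonnegative without changing \<open>norm y\<close>. It then
  coincides with the real inner product, to which \<open>norm_cauchy_schwarz\<close>
  applies.\<close>

lemma cmod_cinner_le: "cmod (cinner x y) \<le> norm x * norm y"
proof (cases "cinner x y = 0")
  case False
  define a where "a = cnj (cinner x y) / cmod (cinner x y)"
  have "cmod a = 1" using False by (simp add: a_def norm_divide)
  then have "norm (a *\<^sub>C y) = norm y"
    by (simp add: norm_eq_sqrt_cinner cinner_scaleC_left cinner_scaleC_right norm_mult)
  moreover have "cinner x (a *\<^sub>C y) = complex_of_real (cmod (cinner x y))"
    using False by (simp add: a_def cinner_scaleC_right complex_norm_square[symmetric] power2_eq_square mult.commute)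
  then have "inner x (a *\<^sub>C y) = cmod (cinner x y)" by (simp add: inner_eq_Re_cinner)
  ultimately show ?thesis using norm_cauchy_schwarz[of x "a *\<^sub>C y"] by simp
qed simp

lemma norm_scaleC: "norm (a *\<^sub>C x) = cmod a * norm (x::'a::complex_inner)"
  by (simp add: norm_eq_sqrt_cinner cinner_scaleC_left cinner_scaleC_right norm_mult real_sqrt_mult)

lemma bounded_clinearI:
  assumes "clinear f" "\<And>x. norm (f x) \<le> norm x * K"
  shows "bounded_clinear f"
proof -
  have "f (r *\<^sub>R x) = r *\<^sub>R f x" for r x
    using assms(1) by (simp add: scaleR_scaleC cvp.linear_scale)
  then show ?thesis
    unfolding bounded_clinear_def using assms
    by (auto intro!: bounded_linear_intro simp: cvp.linear_add cvp.linear_scale)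
qed

section \<open>Orthonormal bases and adjoints in finite dimension\<close>

definition corthonormal :: "'a::complex_inner set \<Rightarrow> bool" where
  "corthonormal E \<longleftrightarrow> (\<forall>x\<in>E. \<forall>y\<in>E. cinner x y = (if x = y then 1 else 0))"

text \<open>Gram-Schmidt: \<open>p\<close> is the orthogonal projection of the new vector
  \<open>v\<close> onto \<open>cspan E\<close>. Either \<open>v = p\<close> and nothing is added, or
  the normalised remainder \<open>w\<close> joins \<open>E\<close>.\<close>

lemma corthonormal_span_exists:
  fixes b :: "'a::complex_inner set"
  assumes "finite b"
  shows "\<exists>E. finite E \<and> corthonormal E \<and> cspan E = cspan b"
  using assms
proof (induction b)
  case empty
  show ?case by (intro exI[of _ "{}"]) (simp add: corthonormal_def)
next
  case (insert v b)
  then obtain E where E: "finite E" "corthonormal E" "cspan E = cspan b" by blast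
  define p where "p = (\<Sum>i\<in>E. cinner i v *\<^sub>C i)"
  have p: "p \<in> cspan E"
    unfolding p_def by (intro complex_vector.span_sum complex_vector.span_scale complex_vector.span_base)
  show ?case
  proof (cases "v = p")
    case True
    then have "cspan (insert v b) = cspan b"
      using p E by (simp add: complex_vector.span_redundant)
    then show ?thesis using E by auto
  next
    case False
    define r where "r = inverse (complex_of_real (norm (v - p)))"
    define w where "w = r *\<^sub>C (v - p)"
    have r: "r \<noteq> 0" using False by (simp add: r_def)
    have orth: "cinner i w = 0" if "i \<in> E" for i
    proof -
      have "cinner i p = (\<Sum>j\<in>E. if i = j then cinner j v else 0)"
        unfolding p_def cinner_sum_right cinner_scaleC_right
        by (rule sum.cong) (use E(2) that in \<open>auto simp: corthonormal_def\<close>)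
      then show ?thesis using E(1) that by (simp add: w_def cinner_scaleC_right cinner_diff_right)
    qed
    have unit: "cinner w w = 1"
      using False by (simp add: w_def r_def cinner_self norm_scaleC norm_inverse)
    have "cinner w i = 0" if "i \<in> E" for i
      using orth[OF that] by (subst cinner_commute) simp
    then have "corthonormal (insert w E)"
      using E(2) orth unit by (auto simp: corthonormal_def)
    moreover have "cspan (insert w E) = cspan (insert v b)"
    proof -
      have p': "p \<in> cspan (insert x E)" for x
        using p complex_vector.span_mono[of E "insert x E"] by blast
      have "w \<in> cspan (insert v E)"
        unfolding w_def
        by (intro complex_vector.span_scale complex_vector.span_diff p' complex_vector.span_base insertI1)
      moreover have "inverse r *\<^sub>C w + p \<in> cspan (insert w E)"
        by (intro complex_vector.span_add complex_vector.span_scale p' complex_vector.span_base insertI1)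
      then have "v \<in> cspan (insert w E)"
        using r by (simp add: w_def)
      ultimately have "cspan (insert w E) = cspan (insert v E)"
        unfolding complex_vector.span_eq by (auto intro: complex_vector.span_base)
      also have "\<dots> = cspan (insert v b)"
        using E(3) by (simp add: complex_vector.span_insert)
      finally show ?thesis .
    qed
    ultimately show ?thesis using E(1) by blast
  qed
qed

lemma ecdim_UNIV_basis:
  assumes "ecdim (UNIV :: 'b::complex_vector set) = enat n"
  obtains b :: "'b::complex_vector set" where "finite b" "cspan b = UNIV" "card b = n"
proof -
  obtain c :: "'b set" where c: "finite c" "UNIV \<subseteq> cspan c"
    using assms by (auto simp: ecdim_def split: if_splits)
  have "cdim (UNIV :: 'b set) = n" using assms by (auto simp: ecdim_def split: if_splits)
  moreover obtain b :: "'b set" where b: "\<not> cdependent b" "UNIV \<subseteq> cspan b" "card b = cdim (UNIV :: 'b set)"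
    by (rule complex_vector.basis_exists[of "UNIV :: 'b set"])
  \<comment> \<open>The value of \<open>card b\<close> alone would not exclude an infinite
    \<open>b\<close>, whose \<open>card\<close> is 0; independence inside the span of the finite set
    \<open>c\<close> does.\<close>
  moreover have "finite b"
  proof -
    have "b \<subseteq> cspan c" using c(2) by (rule subset_trans[OF subset_UNIV])
    then show ?thesis using complex_vector.independent_span_bound[OF c(1) b(1)] by simp
  qed
  ultimately show ?thesis using that[of b] by (simp add: top.extremum_unique)
qed

text \<open>An orthonormal basis \<open>E\<close> of the finite-dimensional domain gives the adjoint
  explicitly as a finite sum, which also yields its boundedness. This serves both the given
  \<open>V\<close> and the map \<open>Y\<close> constructed later.\<close>

lemma cadjoint_exists_finite_dim:
  fixes f :: "'b::complex_inner \<Rightarrow> 'a::complex_inner"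
  assumes dim: "finite b" "cspan b = (UNIV :: 'b set)" and f: "clinear f"
  obtains S where "is_cadjoint f S" "bounded_clinear S"
proof -
  obtain E where E: "finite E" "corthonormal E" "cspan E = (UNIV :: 'b set)"
    using corthonormal_span_exists[OF dim(1)] dim(2) by blast
  define S where "S x = (\<Sum>i\<in>E. cinner (f i) x *\<^sub>C i)" for x
  have eq: "cinner (f x) y = cinner x (S y)" for x y
  proof -
    have "x \<in> cspan E" using E by simp
    then show ?thesis
    proof (induction rule: complex_vector.span_induct_alt)
      case base
      then show ?case using f by (simp add: cvp.linear_0)
    next
      case (step c u v)
      have "cinner u (S y) = (\<Sum>j\<in>E. if u = j then cinner (f j) y else 0)"
        unfolding S_def cinner_sum_right cinner_scaleC_right
        by (rule sum.cong) (use E(2) step in \<open>auto simp: corthonormal_def\<close>)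
      then have "cinner u (S y) = cinner (f u) y" using E(1) step by simp
      then show ?case using f step
        by (simp add: cvp.linear_add cvp.linear_scale cinner_add_left cinner_scaleC_left)
    qed
  qed
  have "clinear S"
    by (rule clinearI)
      (auto simp: S_def cinner_add_right cinner_scaleC_right scaleC_add_left sum.distrib
        complex_vector.scale_sum_right scaleC_scaleC)
  moreover have "norm (S x) \<le> norm x * (\<Sum>i\<in>E. norm (f i) * norm i)" for x
  proof -
    have "norm (S x) \<le> (\<Sum>i\<in>E. norm (cinner (f i) x *\<^sub>C i))" unfolding S_def by (rule norm_sum)
    also have "\<dots> \<le> (\<Sum>i\<in>E. (norm (f i) * norm x) * norm i)"
      unfolding norm_scaleC by (intro sum_mono mult_right_mono cmod_cinner_le) auto
    also have "\<dots> = norm x * (\<Sum>i\<in>E. norm (f i) * norm i)"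
      by (simp add: sum_distrib_left algebra_simps)
    finally show ?thesis .
  qed
  ultimately show ?thesis using eq that[of S] bounded_clinearI unfolding is_cadjoint_def by blast
qed

section \<open>From spanning eigenvectors to a Riccati solution\<close>

lemma is_cadjoint_flip:
  assumes "is_cadjoint T S"
  shows "is_cadjoint S T"
  unfolding is_cadjoint_def
proof (intro allI)
  fix x y
  have "cinner (S x) y = cnj (cinner (T y) x)"
    using assms by (simp add: is_cadjoint_def cinner_commute[of "S x"])
  then show "cinner (S x) y = cinner x (T y)" by (simp add: cinner_commute[of x])
qed

text \<open>Pairing the Riccati expression with an arbitrary \<open>h\<close> moves every operator
  to the side of \<open>h\<close> and leaves \<open>eq\<close> paired with \<open>x\<close>. The
  minus sign in the solution flips the terms linear in \<open>Y'\<close> but cancels in the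
  quadratic one.\<close>

lemma riccati_solution_if_dual_solution:
  assumes A0: "is_cadjoint A\<^sub>0 A\<^sub>0" and A1: "is_cadjoint A\<^sub>1 A\<^sub>1" and V: "is_cadjoint V V'"
    and Y: "is_cadjoint Y Y'" "clinear Y"
    and eq: "\<And>h. A\<^sub>0 (Y h) + V h = Y (V' (Y h) + A\<^sub>1 h)"
  shows "riccati_solution A\<^sub>0 A\<^sub>1 V (\<lambda>x. - Y' x)"
  unfolding riccati_solution_def cadjoint_eqI[OF V]
proof (intro allI cinner_extensionality_left)
  fix x h
  \<comment> \<open>In this order, the five rules move \<open>A\<^sub>0\<close>,
    \<open>A\<^sub>1\<close>, \<open>V\<close>, \<open>Y\<close> and \<open>V'\<close> from the
    first argument of \<open>cinner\<close> to the second.\<close>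
  note adj = A0 A1 V Y(1) is_cadjoint_flip[OF V]
  note adj = adj[unfolded is_cadjoint_def, rule_format]
  have t1: "cinner h (A\<^sub>1 (- Y' x)) = - cinner (Y (A\<^sub>1 h)) x"
    using adj(2)[of h "- Y' x"] by (simp add: adj(4) cinner_minus_right)
  have t2: "cinner h (- Y' (A\<^sub>0 x)) = - cinner (A\<^sub>0 (Y h)) x"
    by (simp add: adj(1,4) cinner_minus_right)
  have "cinner h (- Y' (V (- Y' x))) = - cinner (Y h) (V (- Y' x))"
    by (simp only: cinner_minus_right adj(4))
  also have "\<dots> = - cinner (V' (Y h)) (- Y' x)" by (simp only: adj(5))
  also have "\<dots> = cinner (Y (V' (Y h))) x" by (simp only: cinner_minus_right minus_minus adj(4))
  finally have t3: "cinner h (- Y' (V (- Y' x))) = cinner (Y (V' (Y h))) x" .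
  have t4: "cinner h (V' x) = cinner (V h) x" by (simp add: adj(3))
  have "cinner h (A\<^sub>1 (- Y' x) - - Y' (A\<^sub>0 x) - - Y' (V (- Y' x)) + V' x)
      = cinner (A\<^sub>0 (Y h) + V h) x - cinner (Y (V' (Y h))) x - cinner (Y (A\<^sub>1 h)) x"
    by (simp only: cinner_add_right cinner_diff_right cinner_add_left t1 t2 t3 t4) simp
  moreover have "cinner (A\<^sub>0 (Y h) + V h) x = cinner (Y (V' (Y h)) + Y (A\<^sub>1 h)) x"
    using eq[of h] by (simp add: cvp.linear_add[OF Y(2)])
  ultimately show "cinner h (A\<^sub>1 (- Y' x) - - Y' (A\<^sub>0 x) - - Y' (V (- Y' x)) + V' x) = cinner h 0"
    by (simp add: cinner_add_left)
qed

text \<open>The common core of (i) and (ii). A basis \<open>c\<close> of the second space is chosen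
  among the second components of \<open>S\<close>, each basis vector is lifted to a member of
  \<open>S\<close>, and \<open>Y\<close> is the linear map sending it to the first component of its
  lift. The eigenvalues may differ from one basis vector to another.\<close>

lemma riccati_solution_if_eigenvectors_span:
  fixes A\<^sub>0 :: "'a::complex_inner \<Rightarrow> 'a" and A\<^sub>1 :: "'b::complex_inner \<Rightarrow> 'b"
  assumes fin: "finite b" "cspan b = (UNIV :: 'b set)"
    and A0: "bounded_selfadjoint A\<^sub>0" and A1: "bounded_selfadjoint A\<^sub>1" and V: "bounded_clinear V"
    and S: "\<And>u. u \<in> S \<Longrightarrow> \<exists>\<mu>. block_operator A\<^sub>0 V (cadjoint V) A\<^sub>1 u = \<mu> *\<^sub>C u"
    and span: "cspan (snd ` S) = UNIV"
  shows "\<exists>X. bounded_clinear X \<and> riccati_solution A\<^sub>0 A\<^sub>1 V X"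
proof -
  obtain V' where V': "is_cadjoint V V'" "bounded_clinear V'"
    using cadjoint_exists_finite_dim[OF fin bounded_clinear_imp_clinear[OF V]] .
  have cadj: "cadjoint V = V'" using V' by (simp add: cadjoint_eqI)
  have lin: "clinear A\<^sub>0" "clinear A\<^sub>1" "clinear V" "clinear V'"
    using A0 A1 V V' by (auto simp: bounded_selfadjoint_def bounded_clinear_imp_clinear)
  obtain c where c: "c \<subseteq> snd ` S" "\<not> cdependent c" "snd ` S \<subseteq> cspan c"
    using complex_vector.maximal_independent_subset by blast
  have c_span: "cspan c = UNIV"
    using c(3) span by (metis complex_vector.span_mono complex_vector.span_span top.extremum_uniqueI)
  have "\<forall>h\<in>c. \<exists>u. u \<in> S \<and> snd u = h" using c(1) by blast
  from bchoice[OF this] obtain g where g: "\<And>h. h \<in> c \<Longrightarrow> g h \<in> S \<and> snd (g h) = h" by blast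
  obtain Y where Y: "clinear Y" "\<And>h. h \<in> c \<Longrightarrow> Y h = fst (g h)"
    using cvp.linear_independent_extend[OF c(2), of "fst \<circ> g"] by auto
  \<comment> \<open>Once \<open>Y\<close> is fixed, both sides are linear in \<open>h\<close>, even
    the term quadratic in \<open>Y\<close>, so the basis \<open>c\<close> decides.\<close>
  have eq: "A\<^sub>0 (Y h) + V h = Y (V' (Y h) + A\<^sub>1 h)" for h
  proof -
    have "h \<in> cspan c" using c_span by simp
    then show ?thesis
    proof (induction rule: complex_vector.span_induct_alt)
      case base
      then show ?case using lin Y(1) by (simp add: cvp.linear_0)
    next
      case (step a u v)
      obtain \<mu> where "block_operator A\<^sub>0 V V' A\<^sub>1 (g u) = \<mu> *\<^sub>C g u"
        using S g step cadj by blast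
      moreover have "g u = (Y u, u)" using g[of u] Y(2)[of u] step by (simp add: prod_eq_iff)
      ultimately have "A\<^sub>0 (Y u) + V u = \<mu> *\<^sub>C Y u" "V' (Y u) + A\<^sub>1 u = \<mu> *\<^sub>C u"
        by (auto simp: block_operator_def scaleC_prod_def)
      \<comment> \<open>The second component of the eigenvalue equation eliminates \<mu> from the
        first: \<mu> passes inside \<open>Y\<close>, where it multiplies \<open>u\<close>.\<close>
      then have u: "A\<^sub>0 (Y u) + V u = Y (V' (Y u) + A\<^sub>1 u)"
        using Y(1) by (simp add: cvp.linear_scale)
      have "A\<^sub>0 (Y (a *\<^sub>C u + v)) + V (a *\<^sub>C u + v)
          = a *\<^sub>C (A\<^sub>0 (Y u) + V u) + (A\<^sub>0 (Y v) + V v)"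
        using lin Y(1) by (simp add: cvp.linear_scale cvp.linear_add scaleC_add_right)
      also have "\<dots> = Y (V' (Y (a *\<^sub>C u + v)) + A\<^sub>1 (a *\<^sub>C u + v))"
        unfolding u step(2)
        using lin Y(1) by (simp add: cvp.linear_scale cvp.linear_add scaleC_add_right)
      finally show ?case .
    qed
  qed
  obtain Y' where Y': "is_cadjoint Y Y'" "bounded_clinear Y'"
    using cadjoint_exists_finite_dim[OF fin Y(1)] .
  have "bounded_clinear (\<lambda>x. - Y' x)"
    using Y'(2) by (auto simp: bounded_clinear_def bounded_linear_minus)
  then show ?thesis
    using riccati_solution_if_dual_solution[OF _ _ V'(1) Y'(1) Y(1) eq] A0 A1
    by (auto simp: bounded_selfadjoint_def)
qed

section \<open>Eigenspaces of the block operator under the cyclicity assumption\<close>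

lemma bounded_linear_cinner_left: "bounded_linear (\<lambda>v. cinner v x)"
  by (rule bounded_linear_intro[where K = "norm x"])
    (auto simp: cinner_add_left scaleR_scaleC cinner_scaleC_left cmod_cinner_le scaleR_conv_of_real)

text \<open>Antilinearity in the first argument still makes the vectors orthogonal to
  \<open>x\<close> a complex subspace. It is closed because \<open>cinner\<close> is continuous in
  that argument, being bounded and real-linear there.\<close>

lemma cinner_eq_0_closure:
  assumes "\<And>v. v \<in> S \<Longrightarrow> cinner v x = 0" "y \<in> closure (cspan S)"
  shows "cinner y x = 0"
proof -
  have "cinner v x = 0" if "v \<in> cspan S" for v
    using that by (induction rule: complex_vector.span_induct_alt)
      (auto simp: cinner_add_left cinner_scaleC_left assms(1))
  then have "cspan S \<subseteq> {v. cinner v x = 0}" by auto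
  moreover have "closed {v. cinner v x = 0}"
    by (intro closed_Collect_eq linear_continuous_on bounded_linear_cinner_left continuous_intros)
  ultimately show ?thesis using assms(2) closure_minimal by blast
qed

text \<open>The two equations in \<open>x\<close> say that \<open>(x, 0)\<close> satisfies the
  eigenvalue equation of the block operator. Symmetry moves one \<open>A\<close> at a time onto
  \<open>x\<close>, each time producing a factor \<mu>, until the pairing of \<open>V h\<close> with
  \<open>x\<close> remains, which is that of \<open>h\<close> with \<open>V' x = 0\<close>. By
  density \<open>x\<close> is orthogonal to itself.\<close>

lemma eigenvector_orthogonal_cyclic_eq_0:
  assumes A: "is_cadjoint A A" and V: "is_cadjoint V V'"
    and cyclic: "cyclic_generating_subspace A (range V)"
    and x: "A x = \<mu> *\<^sub>C x" "V' x = 0"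
  shows "x = 0"
proof -
  have orth: "cinner ((A ^^ k) (V h)) x = 0" for k h
  proof (induction k)
    case 0
    show ?case using V x(2) by (simp add: is_cadjoint_def)
  next
    case (Suc k)
    have "cinner (A ((A ^^ k) (V h))) x = cinner ((A ^^ k) (V h)) (A x)"
      using A unfolding is_cadjoint_def by blast
    then show ?case using Suc x(1) by (simp add: cinner_scaleC_right)
  qed
  have "cinner x x = 0"
    by (rule cinner_eq_0_closure[of "{(A ^^ k) w | k w. w \<in> range V}"])
      (use orth cyclic in \<open>auto simp: cyclic_generating_subspace_def\<close>)
  then show ?thesis by (simp add: cinner_self)
qed

text \<open>A dimension count: \<open>snd\<close> is injective on the eigenspace, so a basis of it
  maps to \<open>card b\<close> independent vectors, and no independent set in the second space is
  larger.\<close>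

lemma cspan_snd_eigenspace_eq_UNIV:
  fixes A\<^sub>0 :: "'a::complex_inner \<Rightarrow> 'a" and A\<^sub>1 :: "'b::complex_inner \<Rightarrow> 'b"
  assumes fin: "finite b" "cspan b = (UNIV :: 'b set)"
    and A0: "bounded_selfadjoint A\<^sub>0" and A1: "bounded_selfadjoint A\<^sub>1" and V: "bounded_clinear V"
    and cyclic: "cyclic_generating_subspace A\<^sub>0 (range V)"
    and mult: "eigenvalue_multiplicity (block_operator A\<^sub>0 V (cadjoint V) A\<^sub>1) \<mu> = enat (card b)"
  shows "cspan (snd ` eigenspace (block_operator A\<^sub>0 V (cadjoint V) A\<^sub>1) \<mu>) = UNIV"
proof -
  let ?B = "block_operator A\<^sub>0 V (cadjoint V) A\<^sub>1"
  define E where "E = eigenspace ?B \<mu>"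
  obtain V' where V': "is_cadjoint V V'" "bounded_clinear V'"
    using cadjoint_exists_finite_dim[OF fin bounded_clinear_imp_clinear[OF V]] .
  have cadj: "cadjoint V = V'" using V' by (simp add: cadjoint_eqI)
  have lin: "clinear A\<^sub>0" "clinear A\<^sub>1" "clinear V" "clinear V'"
    using A0 A1 V V' by (auto simp: bounded_selfadjoint_def bounded_clinear_imp_clinear)
  have mem: "(x, y) \<in> E \<longleftrightarrow> A\<^sub>0 x + V y = \<mu> *\<^sub>C x \<and> V' x + A\<^sub>1 y = \<mu> *\<^sub>C y" for x y
    by (simp add: E_def eigenspace_def block_operator_def cadj scaleC_prod_def)
  have sub: "csubspace E"
  proof (rule complex_vector.subspaceI)
    show "0 \<in> E" using lin by (simp add: zero_prod_def mem cvp.linear_0)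
  next
    fix p q assume pq: "p \<in> E" "q \<in> E"
    obtain x y x' y' where [simp]: "p = (x, y)" "q = (x', y')" by (cases p, cases q)
    have "A\<^sub>0 (x + x') + V (y + y') = (A\<^sub>0 x + V y) + (A\<^sub>0 x' + V y')"
      "V' (x + x') + A\<^sub>1 (y + y') = (V' x + A\<^sub>1 y) + (V' x' + A\<^sub>1 y')"
      using lin by (simp_all add: cvp.linear_add)
    then show "p + q \<in> E" using pq by (simp add: mem scaleC_add_right)
  next
    fix a p assume p: "p \<in> E"
    obtain x y where [simp]: "p = (x, y)" by (cases p)
    have "A\<^sub>0 (a *\<^sub>C x) + V (a *\<^sub>C y) = a *\<^sub>C (A\<^sub>0 x + V y)"
      "V' (a *\<^sub>C x) + A\<^sub>1 (a *\<^sub>C y) = a *\<^sub>C (V' x + A\<^sub>1 y)"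
      using lin by (simp_all add: cvp.linear_scale scaleC_add_right)
    then show "a *\<^sub>C p \<in> E" using p by (simp add: mem scaleC_prod_def scaleC_scaleC mult.commute)
  qed
  have snd: "clinear (snd :: 'a \<times> 'b \<Rightarrow> 'b)" by (rule clinearI) (auto simp: scaleC_prod_def)
  have inj: "inj_on snd E"
  proof (rule inj_onI)
    fix p q assume pq: "p \<in> E" "q \<in> E" "snd p = snd q"
    \<comment> \<open>The difference of two points with equal image under \<open>snd\<close> has the
      form excluded by \<open>eigenvector_orthogonal_cyclic_eq_0\<close> unless it is zero.\<close>
    then have "(fst p - fst q, 0) \<in> E"
      using complex_vector.subspace_diff[OF sub pq(1,2)] by (simp add: minus_prod_def)
    then have "A\<^sub>0 (fst p - fst q) = \<mu> *\<^sub>C (fst p - fst q)" "V' (fst p - fst q) = 0"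
      using lin by (auto simp: mem cvp.linear_0)
    then have "fst p - fst q = 0"
      using A0 eigenvector_orthogonal_cyclic_eq_0[OF _ V'(1) cyclic]
      unfolding bounded_selfadjoint_def by blast
    then show "p = q" using pq(3) by (simp add: prod_eq_iff)
  qed
  have "cdim E = card b"
    using mult by (auto simp: eigenvalue_multiplicity_def ecdim_def E_def split: if_splits)
  then obtain c where c: "c \<subseteq> E" "\<not> cdependent c" "E \<subseteq> cspan c" "card c = card b"
    by (metis complex_vector.basis_exists)
  have "cspan c = E"
    using c sub by (metis complex_vector.span_mono complex_vector.span_eq_iff subset_antisym)
  then have indep: "\<not> cdependent (snd ` c)"
    using cvp.linear_independent_injective_image[OF snd c(2)] inj by simp
  have bound: "finite d \<and> card d \<le> card b" if "\<not> cdependent d" for d :: "'b set"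
    using complex_vector.independent_span_bound[OF fin(1) that] fin(2) by simp
  have card: "card (snd ` c) = card b"
    using c(4) card_image[OF inj_on_subset[OF inj c(1)]] by simp
  \<comment> \<open>A vector outside the span would extend the image of \<open>c\<close> to an
    independent set of \<open>Suc (card b)\<close> elements.\<close>
  have "v \<in> cspan (snd ` c)" for v
  proof (rule ccontr)
    assume v: "v \<notin> cspan (snd ` c)"
    then have "v \<notin> snd ` c" by (rule contrapos_nn) (rule complex_vector.span_base)
    then have "card (insert v (snd ` c)) = Suc (card b)"
      using bound[OF indep] card by (metis card_insert_disjoint)
    then show False
      using bound[OF complex_vector.independent_insertI[OF v indep]] by (metis not_less_eq_eq order_refl)
  qed
  then have "cspan (snd ` c) = UNIV" by (intro UNIV_eq_I[symmetric])
  then show ?thesis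
    using complex_vector.span_mono[OF image_mono[OF c(1)], of snd]
    unfolding E_def by (simp add: top.extremum_unique)
qed

section \<open>A cyclic generating subspace for the block operator\<close>

lemma cspan_invariant:
  assumes "clinear f" "\<And>x. x \<in> S \<Longrightarrow> f x \<in> cspan S" "x \<in> cspan S"
  shows "f x \<in> cspan S"
  using assms(3)
proof (induction rule: complex_vector.span_induct_alt)
  case base
  show ?case by (simp add: cvp.linear_0[OF assms(1)] complex_vector.span_zero)
next
  case (step c u v)
  have "c *\<^sub>C f u + f v \<in> cspan S"
    using assms(2)[OF step(1)] step(2) by (intro complex_vector.span_add complex_vector.span_scale)
  then show ?case by (simp add: cvp.linear_add[OF assms(1)] cvp.linear_scale[OF assms(1)])
qed

text \<open>The span \<open>M\<close> of the orbit is invariant and contains every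
  \<open>(0, h)\<close>, so second components may be subtracted freely. Applying the block operator
  to \<open>(0, h)\<close> thus puts \<open>(V h, 0)\<close> into \<open>M\<close>, and further
  applications give \<open>((A\<^sub>0 ^^ k) (V h), 0)\<close>.\<close>

lemma cyclic_generating_subspace_block_operator:
  fixes A\<^sub>0 :: "'a::complex_inner \<Rightarrow> 'a" and A\<^sub>1 :: "'b::complex_inner \<Rightarrow> 'b"
  assumes lin: "clinear A\<^sub>0" "clinear V" "clinear V'" "clinear A\<^sub>1"
    and cyclic: "cyclic_generating_subspace A\<^sub>0 (range V)"
  shows "cyclic_generating_subspace (block_operator A\<^sub>0 V V' A\<^sub>1) ({0} \<times> UNIV)"
proof -
  let ?B = "block_operator A\<^sub>0 V V' A\<^sub>1"
  define M where "M = cspan {(?B ^^ k) w | k w. w \<in> {0} \<times> (UNIV :: 'b set)}"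
  have B: "clinear ?B"
    by (rule clinearI)
      (use lin in \<open>auto simp: block_operator_def scaleC_prod_def cvp.linear_add cvp.linear_scale
        scaleC_add_right split: prod.splits\<close>)
  have M_B: "?B p \<in> M" if "p \<in> M" for p
    using that unfolding M_def
  proof (rule cspan_invariant[OF B, rotated])
    fix x assume "x \<in> {(?B ^^ k) w | k w. w \<in> {0} \<times> (UNIV :: 'b set)}"
    then obtain k w where "w \<in> {0} \<times> (UNIV :: 'b set)" "?B x = (?B ^^ Suc k) w" by auto
    then show "?B x \<in> cspan {(?B ^^ k) w | k w. w \<in> {0} \<times> (UNIV :: 'b set)}"
      by (blast intro: complex_vector.span_base)
  qed
  have M_snd: "(0, h) \<in> M" for h :: 'b
    unfolding M_def
    by (rule complex_vector.span_base, rule CollectI, rule exI[of _ 0], rule exI[of _ "(0, h)"]) simp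
  have M_sub: "csubspace M" unfolding M_def by (rule complex_vector.subspace_span)
  have M_B_fst: "(A\<^sub>0 x + V y, 0) \<in> M" if "(x, y) \<in> M" for x y
    using complex_vector.subspace_diff[OF M_sub M_B[OF that] M_snd[of "V' x + A\<^sub>1 y"]]
    by (simp add: block_operator_def)
  have gen: "((A\<^sub>0 ^^ k) (V h), 0) \<in> M" for k h
  proof (induction k)
    case 0
    show ?case using M_B_fst[OF M_snd[of h]] lin by (simp add: cvp.linear_0)
  next
    case (Suc k)
    then show ?case using M_B_fst[OF Suc] lin by (simp add: cvp.linear_0)
  qed
  have M_fst: "(x, h) \<in> M" if "x \<in> cspan {(A\<^sub>0 ^^ k) w | k w. w \<in> range V}" for x h
  proof -
    have "(x, 0) \<in> M" using that
    proof (induction rule: complex_vector.span_induct_alt)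
      case base
      show ?case using M_snd by simp
    next
      case (step a u v)
      then have "(u, 0) \<in> M" using gen by auto
      then have "a *\<^sub>C (u, 0) + (v, 0) \<in> M"
        using step(2) M_sub by (simp add: complex_vector.subspace_add complex_vector.subspace_scale)
      then show ?case by (simp add: scaleC_prod_def)
    qed
    from complex_vector.subspace_add[OF M_sub this M_snd[of h]] show ?thesis by simp
  qed
  then have "cspan {(A\<^sub>0 ^^ k) w | k w. w \<in> range V} \<times> UNIV \<subseteq> M" by auto
  \<comment> \<open>The closure of a product is the product of the closures, and the first factor is
    dense by cyclicity of \<open>range V\<close>.\<close>
  from closure_mono[OF this] have "closure M = UNIV"
    using cyclic by (auto simp: cyclic_generating_subspace_def closure_Times)
  moreover have "csubspace ({0} \<times> (UNIV :: 'b set) :: ('a \<times> 'b) set)"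
    by (rule complex_vector.subspaceI) (auto simp: scaleC_prod_def zero_prod_def)
  ultimately show ?thesis by (simp add: cyclic_generating_subspace_def M_def)
qed

lemma ecdim_le_card:
  assumes "finite c" "W \<subseteq> cspan c"
  shows "ecdim W \<le> enat (card c)"
proof -
  have "\<exists>b. finite b \<and> W \<subseteq> cspan b" using assms by blast
  then show ?thesis
    unfolding ecdim_def using complex_vector.dim_le_card[OF assms(2,1)] by (simp only: if_True enat_ord_simps)
qed

theorem theorem1p1:
  fixes A\<^sub>0 :: "'a::chilbert_space \<Rightarrow> 'a"
    and A\<^sub>1 :: "'b::chilbert_space \<Rightarrow> 'b"
    and V :: "'b \<Rightarrow> 'a"
    and B :: "'a \<times> 'b \<Rightarrow> 'a \<times> 'b"
    and n :: nat
    and U :: "('a \<times> 'b) set"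
  assumes "separable_space (euclidean :: ('a \<times> 'b) topology)"
    and "bounded_selfadjoint A\<^sub>0"
    and "bounded_selfadjoint A\<^sub>1"
    and "bounded_clinear V"
    and "B = block_operator A\<^sub>0 V (cadjoint V) A\<^sub>1"
    and "ecdim (UNIV :: 'b set) = enat n"
    and "cyclic_generating_subspace A\<^sub>0 (range V)"
    and "U = cspan {u. \<exists>\<mu> \<in> point_spectrum B - point_spectrum A\<^sub>0. is_eigenvector B \<mu> u}"
  shows "(spectral_multiplicity B \<le> enat n \<and>
      ((\<exists>\<mu> \<in> point_spectrum B. eigenvalue_multiplicity B \<mu> = enat n) \<longrightarrow>
        (\<exists>X. bounded_clinear X \<and> riccati_solution A\<^sub>0 A\<^sub>1 V X))) \<and>
    (eigenvalue_count B (- point_spectrum A\<^sub>0) \<ge> enat n \<and>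
      orthogonal_projection ({0} \<times> UNIV) ` U = {0} \<times> UNIV \<longrightarrow>
        (\<exists>X. bounded_clinear X \<and> riccati_solution A\<^sub>0 A\<^sub>1 V X))"
proof (intro conjI impI)
  obtain b :: "'b set" where b: "finite b" "cspan b = UNIV" "card b = n"
    using ecdim_UNIV_basis[OF assms(6)] .
  obtain V' where V': "is_cadjoint V V'" "bounded_clinear V'"
    using cadjoint_exists_finite_dim[OF b(1,2) bounded_clinear_imp_clinear[OF assms(4)]] .
  have B: "B = block_operator A\<^sub>0 V V' A\<^sub>1" using assms(5) V'(1) by (simp add: cadjoint_eqI)
  \<comment> \<open>The set \<open>S\<close> stays open here: it becomes an eigenspace in (i) and
    the set of eigenvectors generating \<open>U\<close> in (ii).\<close>
  note riccati = riccati_solution_if_eigenvectors_span[OF b(1,2) assms(2-4), folded assms(5)]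
  show "spectral_multiplicity B \<le> enat n"
  proof -
    have "cyclic_generating_subspace B ({0} \<times> UNIV)"
      unfolding B using assms(2-4) V'(2)
      by (intro cyclic_generating_subspace_block_operator assms(7) bounded_clinear_imp_clinear)
        (auto simp: bounded_selfadjoint_def)
    then have "spectral_multiplicity B \<le> ecdim ({0} \<times> UNIV :: ('a \<times> 'b) set)"
      unfolding spectral_multiplicity_def by (intro INF_lower) simp
    also have "\<dots> \<le> enat (card (Pair (0 :: 'a) ` b))"
    proof (rule ecdim_le_card)
      have "clinear (Pair (0 :: 'a) :: 'b \<Rightarrow> _)" by (rule clinearI) (auto simp: scaleC_prod_def)
      from cvp.linear_span_image[OF this, of b]
      show "{0} \<times> UNIV \<subseteq> cspan (Pair (0 :: 'a) ` b)" using b(2) by auto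
    qed (use b in simp)
    also have "\<dots> \<le> enat n" using b by (simp add: card_image_le flip: b(3))
    finally show ?thesis .
  qed
  show "\<exists>X. bounded_clinear X \<and> riccati_solution A\<^sub>0 A\<^sub>1 V X"
    if ex: "\<exists>\<mu>\<in>point_spectrum B. eigenvalue_multiplicity B \<mu> = enat n"
  proof -
    obtain \<mu> where "eigenvalue_multiplicity B \<mu> = enat n" using ex by blast
    then have "cspan (snd ` eigenspace B \<mu>) = UNIV"
      using cspan_snd_eigenspace_eq_UNIV[OF b(1,2) assms(2-4,7)] b(3) assms(5) by simp
    then show ?thesis by (rule riccati[rotated]) (auto simp: eigenspace_def)
  qed
  show "\<exists>X. bounded_clinear X \<and> riccati_solution A\<^sub>0 A\<^sub>1 V X"
    if U: "eigenvalue_count B (- point_spectrum A\<^sub>0) \<ge> enat n \<and>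
      orthogonal_projection ({0} \<times> UNIV) ` U = {0} \<times> UNIV"
  proof (rule riccati)
    let ?S = "{u. \<exists>\<mu> \<in> point_spectrum B - point_spectrum A\<^sub>0. is_eigenvector B \<mu> u}"
    show "\<exists>\<mu>. B u = \<mu> *\<^sub>C u" if "u \<in> ?S" for u
      using that by (auto simp: is_eigenvector_def)
    have "clinear (snd :: 'a \<times> 'b \<Rightarrow> 'b)" by (rule clinearI) (auto simp: scaleC_prod_def)
    \<comment> \<open>Linear images commute with spans, so the assumption on the projection of
      \<open>U\<close> says exactly that the second components of these eigenvectors span the second
      space.\<close>
    then have "cspan (snd ` ?S) = snd ` U" using assms(8) by (simp add: cvp.linear_span_image)
    moreover have "(\<lambda>p. (0 :: 'a, snd p)) ` U = {0} \<times> UNIV"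
      using U by (simp add: orthogonal_projection_snd)
    then have "snd ` (\<lambda>p. (0 :: 'a, snd p)) ` U = UNIV" by simp
    then have "snd ` U = UNIV" by (simp add: image_image)
    ultimately show "cspan (snd ` ?S) = UNIV" by simp
  qed
qed

end
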